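(* Let $F\in\mathfrak N_n^+(\mathbb D)$ be such that its boundary function $\underline F$ satisfies $\operatorname{ess\,sup}_{t\in\mathbb T}\|\underline F(t)\|<\infty$. Then $F$ is bounded in the unit disc and satisfies $$\sup_{z\in\mathbb D}\|F(z)\|=\operatorname{ess\,sup}_{t\in\mathbb T}\|\underline F(t)\|.$$
   Context: $\mathbb D$ is the open unit disc, $\mathbb T$ the unit circle, $m$ normalized Lebesgue measure on $\mathbb T$ (the essential supremum is with respect to $m$), $\mathfrak M_n$ the complex $n\times n$ matrices with the operator norm induced by the Euclidean norm. Smirnov class: $\mathfrak N_n^+(\mathbb D)$ is the set of holomorphic $F:\mathbb D\to\mathfrak M_n$ such that for each $\epsilon>0$ there is $\delta>0$ with $\int_\Delta \ln^+\|F(rt)\|\,m(dt)<\epsilon$ for all $r\in[0,1)$ and all Borel $\Delta\subseteq\mathbb T$ with $m(\Delta)<\delta$. Such $F$ has a Borel measurable boundary function $\underline F:\mathbb T\to\mathfrak M_n$ with $\underline F(t)=\lim_{r\to1-0}F(rt)$ for $m$-a.e. $t$. *)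

theory Defs
  imports "HOL-Probability.Essential_Supremum" "HOL-Probability.Probability_Measure"
begin

text \<open>Normalized Lebesgue measure on the unit circle, carried by the Borel subsets of the circle:
  the image of the uniform distribution on \<open>[0, 2\<pi>]\<close> under \<open>\<theta> \<mapsto> e\<^sup>i\<^sup>\<theta>\<close>.\<close>

definition circle_measure :: "complex measure" where
  "circle_measure =
     distr (uniform_measure lborel {0..2 * pi}) (restrict_space borel (sphere 0 1)) cis"

lemma space_circle_measure [simp]: "space circle_measure = sphere 0 1"
  by (simp add: circle_measure_def space_restrict_space)

lemma sets_circle_measure [simp, measurable_cong]:
  "sets circle_measure = sets (restrict_space borel (sphere 0 1))"
  by (simp add: circle_measure_def)

lemma measurable_cis_circle:
  "cis \<in> measurable (uniform_measure lborel {0..2 * pi}) (restrict_space borel (sphere 0 1))"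
proof (rule measurable_restrict_space2)
  have "continuous_on UNIV cis"
    by (intro continuous_intros)
  then show "cis \<in> borel_measurable (uniform_measure lborel {0..2 * pi})"
    by (subst measurable_cong_sets[OF _ refl, of _ borel]) (simp_all add: borel_measurable_continuous_onI)
qed simp

lemma prob_space_circle_measure: "prob_space circle_measure"
proof -
  have "prob_space (uniform_measure lborel {0..2 * pi})"
    by (rule prob_space_uniform_measure) auto
  then show ?thesis
    unfolding circle_measure_def by (rule prob_space.prob_space_distr) (rule measurable_cis_circle)
qed

text \<open>The norm on \<open>complex ^ 'n\<close> is the Euclidean one. The library norm on the matrix type is
  the Hilbert-Schmidt norm and is therefore not used.\<close>

definition opnorm :: "complex ^ 'n ^ 'n \<Rightarrow> real" where
  "opnorm A = onorm (\<lambda>x. A *v x)"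

definition ln_plus :: "real \<Rightarrow> real" where
  "ln_plus x = (if x \<le> 1 then 0 else ln x)"

definition smirnov :: "(complex \<Rightarrow> complex ^ 'n ^ 'n) set" where
  "smirnov = {F.
     (\<forall>i j. (\<lambda>z. F z $ i $ j) holomorphic_on ball 0 1) \<and>
     (\<forall>\<epsilon>>0. \<exists>\<delta>>0. \<forall>r\<in>{0..<1}. \<forall>\<Delta>\<in>sets circle_measure.
        measure circle_measure \<Delta> < \<delta> \<longrightarrow>
        (\<integral>\<^sup>+t\<in>\<Delta>. ennreal (ln_plus (opnorm (F (of_real r * t)))) \<partial>circle_measure) < ennreal \<epsilon>)}"

text \<open>A boundary function is determined only up to a null set; any Borel version is admitted.\<close>

definition boundary_function ::
    "(complex \<Rightarrow> complex ^ 'n ^ 'n) \<Rightarrow> (complex \<Rightarrow> complex ^ 'n ^ 'n) \<Rightarrow> bool" where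
  "boundary_function F G \<longleftrightarrow>
     G \<in> borel_measurable circle_measure \<and>
     (AE t in circle_measure. ((\<lambda>r. F (of_real r * t)) \<longlongrightarrow> G t) (at_left (1::real)))"

end

(* Pairing F with vectors reduces the bound to a scalar f with |f| <= C on the boundary. The
   functions v_r(t) = ln (max |f(r t)| C) are continuous on the circle, and approximating them by
   real parts of entire functions gives |f(r z)| <= exp (integral of P_z v_r) from the maximum
   principle and the Poisson formula for entire functions, with no factorization of zeros.
   As r -> 1, uniform integrability makes the right-hand side tend to C. *)

theory Submission
  imports Defs "HOL-Complex_Analysis.Complex_Analysis"
begin

section \<open>Integration over the circle with respect to normalized Lebesgue measure\<close>

interpretation circle: prob_space circle_measure
  by (rule prob_space_circle_measure)

lemma borel_measurable_circle_continuous: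
  fixes h :: "complex \<Rightarrow> 'a::real_normed_vector"
  assumes "continuous_on (sphere 0 1) h"
  shows "h \<in> borel_measurable circle_measure"
  by (subst measurable_cong_sets[OF sets_circle_measure refl])
     (rule borel_measurable_continuous_on_restrict[OF assms])

lemma integrable_circle_continuous:
  fixes h :: "complex \<Rightarrow> 'a::{banach, second_countable_topology}"
  assumes "continuous_on (sphere 0 1) h"
  shows "integrable circle_measure h"
proof -
  have "bounded (h ` sphere 0 1)"
    using assms by (intro compact_imp_bounded compact_continuous_image) auto
  then obtain B where B: "\<And>t. t \<in> sphere 0 1 \<Longrightarrow> norm (h t) \<le> B"
    unfolding bounded_iff by blast
  show ?thesis
  proof (rule circle.integrable_const_bound)
    show "AE t in circle_measure. norm (h t) \<le> B"
      using B by (intro AE_I2) simp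
  qed (rule borel_measurable_circle_continuous[OF assms])
qed

text \<open>This is the bridge between \<open>circle_measure\<close> and contour integrals: the
  library's Cauchy formula, parametrized by the angle, produces a \<open>has_integral\<close> fact
  over \<open>{0..2*pi}\<close>. The factor \<open>2 * pi\<close> undoes the normalization.\<close>

lemma has_integral_circle_measure:
  fixes h :: "complex \<Rightarrow> complex"
  assumes "continuous_on (sphere 0 1) h"
  shows "((\<lambda>\<theta>. h (cis \<theta>)) has_integral (2 * pi * (\<integral>t. h t \<partial>circle_measure))) {0..2*pi}"
proof -
  have cont: "continuous_on UNIV (\<lambda>\<theta>. h (cis \<theta>))"
    by (rule continuous_on_compose2[OF assms]) (auto intro!: continuous_intros)
  then have meas: "(\<lambda>\<theta>. h (cis \<theta>)) \<in> borel_measurable lborel"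
    by (simp add: borel_measurable_continuous_onI)
  have int: "set_integrable lborel {0..2*pi} (\<lambda>\<theta>. h (cis \<theta>))"
    by (rule borel_integrable_atLeastAtMost') (rule continuous_on_subset[OF cont], simp)
  \<comment> \<open>The density is rewritten as the \<open>ennreal\<close> image of a real function,
    which is the form that \<open>integral_density\<close> takes.\<close>
  have unif: "uniform_measure lborel {0..2*pi} =
      density lborel (\<lambda>x. ennreal (indicator {0..2*pi} x / (2*pi)))"
    unfolding uniform_measure_def
    by (intro arg_cong[where f = "density lborel"] ext)
       (auto simp: indicator_def divide_ennreal[symmetric] simp flip: ennreal_1)
  have "(\<integral>t. h t \<partial>circle_measure) = (\<integral>\<theta>. h (cis \<theta>) \<partial>uniform_measure lborel {0..2*pi})"
    unfolding circle_measure_def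
    by (rule integral_distr[OF measurable_cis_circle])
       (rule borel_measurable_continuous_on_restrict[OF assms])
  also have "\<dots> = (\<integral>\<theta>. (indicator {0..2*pi} \<theta> / (2*pi)) *\<^sub>R h (cis \<theta>) \<partial>lborel)"
    unfolding unif using meas by (intro integral_density) auto
  also have "\<dots> = (\<integral>\<theta>. (1 / (2*pi)) *\<^sub>R (indicator {0..2*pi} \<theta> *\<^sub>R h (cis \<theta>)) \<partial>lborel)"
    by (intro Bochner_Integration.integral_cong) auto
  also have "\<dots> = (1 / (2*pi)) *\<^sub>R (LINT \<theta>:{0..2*pi}|lborel. h (cis \<theta>))"
    unfolding set_lebesgue_integral_def by (rule integral_scaleR_right)
  also have "(LINT \<theta>:{0..2*pi}|lborel. h (cis \<theta>)) = integral {0..2*pi} (\<lambda>\<theta>. h (cis \<theta>))"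
    by (rule set_borel_integral_eq_integral(2)[OF int])
  finally have "2 * pi * (\<integral>t. h t \<partial>circle_measure) = integral {0..2*pi} (\<lambda>\<theta>. h (cis \<theta>))"
    by (simp add: scaleR_conv_of_real)
  then show ?thesis
    using set_borel_integral_eq_integral(1)[OF int] by (simp add: has_integral_integral)
qed

section \<open>The Poisson kernel and the Poisson formula for entire functions\<close>

definition poisson_kernel :: "complex \<Rightarrow> complex \<Rightarrow> real" where
  "poisson_kernel z t = (1 - (norm z)\<^sup>2) / (norm (t - z))\<^sup>2"

lemma poisson_kernel_nonneg: "norm z < 1 \<Longrightarrow> 0 \<le> poisson_kernel z t"
  by (simp add: poisson_kernel_def power_le_one)

lemma continuous_on_poisson_kernel:
  "norm z < 1 \<Longrightarrow> continuous_on (sphere 0 1) (poisson_kernel z)"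
  unfolding poisson_kernel_def by (auto intro!: continuous_intros)

lemma poisson_kernel_bounded:
  assumes "norm z < 1"
  shows "\<exists>B>0. \<forall>t\<in>sphere 0 1. poisson_kernel z t \<le> B"
proof -
  have "bounded (poisson_kernel z ` sphere 0 1)"
    using continuous_on_poisson_kernel[OF assms]
    by (intro compact_imp_bounded compact_continuous_image) auto
  then obtain B where "B > 0" "\<And>t. t \<in> sphere 0 1 \<Longrightarrow> norm (poisson_kernel z t) \<le> B"
    unfolding bounded_pos by blast
  then show ?thesis by (force intro!: exI[of _ B])
qed

text \<open>On the circle \<open>1 - cnj z * w = w * cnj (w - z)\<close>, so the Cauchy kernel of
  \<open>q w (1 - |z|\<^sup>2) / (1 - cnj z * w)\<close> at \<open>z\<close> is the Poisson kernel.\<close>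

lemma poisson_formula_entire:
  assumes q: "q holomorphic_on UNIV" and z: "norm z < 1"
  shows "(\<integral>t. poisson_kernel z t * Re (q t) \<partial>circle_measure) = Re (q z)"
proof -
  define K where "K w = q w * of_real (1 - (norm z)\<^sup>2) / (1 - cnj z * w)" for w
  have ne: "1 - cnj z * w \<noteq> 0" if "norm w \<le> 1" for w
  proof
    assume "1 - cnj z * w = 0"
    then have "norm z * norm w = 1"
      by (metis complex_mod_cnj eq_iff_diff_eq_0 norm_mult norm_one)
    moreover have "norm z * norm w \<le> norm z"
      using that by (simp add: mult_left_le)
    ultimately show False using z by simp
  qed
  have "K holomorphic_on cball 0 1"
    unfolding K_def using ne
    by (intro holomorphic_intros holomorphic_on_subset[OF q]) auto
  then have "((\<lambda>u. K u / (u - z)) has_contour_integral 2 * of_real pi * \<i> * K z) (circlepath 0 1)"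
    using z by (intro Cauchy_integral_circlepath_simple) (auto simp: dist_norm)
  then have I1: "((\<lambda>\<theta>. K (cis \<theta>) / (cis \<theta> - z) * \<i> * cis \<theta>) has_integral 2 * of_real pi * \<i> * K z) {0..2*pi}"
    unfolding circlepath_def by (subst (asm) has_contour_integral_part_circlepath_iff) auto
  \<comment> \<open>At \<open>w = z\<close> the denominator of \<open>K\<close> equals
    \<open>1 - (norm z)\<^sup>2\<close>, the factor placed in the numerator; it cancels, and
    Cauchy's formula reproduces \<open>q z\<close> itself.\<close>
  have Kz: "K z = q z"
  proof -
    have "1 - cnj z * z = of_real (1 - (norm z)\<^sup>2)"
      using complex_norm_square[of z] by (simp add: mult.commute)
    then show ?thesis using ne[of z] z by (simp add: K_def)
  qed
  have ker: "K t / (t - z) * \<i> * t = \<i> * (of_real (poisson_kernel z t) * q t)" if "t \<in> sphere 0 1" for t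
  proof -
    have t1: "t * cnj t = 1" using that by (simp add: complex_norm_square[symmetric])
    have "1 - cnj z * t = t * cnj (t - z)" using t1 by (simp add: algebra_simps)
    then have "K t = q t * of_real (1 - (norm z)\<^sup>2) / (t * cnj (t - z))"
      by (simp only: K_def)
    moreover have "of_real (poisson_kernel z t) = of_real (1 - (norm z)\<^sup>2) / ((t - z) * cnj (t - z))"
      by (simp only: poisson_kernel_def of_real_divide complex_norm_square)
    \<comment> \<open>The factor \<open>t\<close> cancels because it is nonzero on the circle;
      division by zero yields zero, so the identity holds for all \<open>u\<close> and
      \<open>d\<close>.\<close>
    moreover have "b * a / (t * u) / d * \<i> * t = \<i> * (a / (d * u) * b)" for a b u d
      using that by (auto simp: field_simps)
    ultimately show ?thesis by simp
  qed
  have contq: "continuous_on (sphere 0 1) (\<lambda>t. of_real (poisson_kernel z t) * q t)"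
    using continuous_on_poisson_kernel[OF z] holomorphic_on_imp_continuous_on[OF q]
    by (intro continuous_intros) (auto intro: continuous_on_subset)
  have "((\<lambda>\<theta>. \<i> * (of_real (poisson_kernel z (cis \<theta>)) * q (cis \<theta>))) has_integral
      2 * of_real pi * \<i> * q z) {0..2*pi}"
    using I1 by (subst (asm) ker) (auto simp: Kz)
  moreover have "((\<lambda>\<theta>. \<i> * (of_real (poisson_kernel z (cis \<theta>)) * q (cis \<theta>))) has_integral
      2 * of_real pi * (\<integral>t. \<i> * (of_real (poisson_kernel z t) * q t) \<partial>circle_measure)) {0..2*pi}"
    using has_integral_circle_measure[OF continuous_on_mult_left[OF contq, of \<i>]]
    unfolding of_real_mult of_real_numeral .
  ultimately have "2 * of_real pi * \<i> * q z =
      2 * of_real pi * (\<integral>t. \<i> * (of_real (poisson_kernel z t) * q t) \<partial>circle_measure)"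
    by (rule has_integral_unique)
  then have "(\<integral>t. of_real (poisson_kernel z t) * q t \<partial>circle_measure) = q z"
    by simp
  then have "Re (q z) = (\<integral>t. Re (of_real (poisson_kernel z t) * q t) \<partial>circle_measure)"
    using integral_Re[OF integrable_circle_continuous[OF contq]] by simp
  then show ?thesis by simp
qed

section \<open>Approximation on the circle by real parts of entire functions, and the Poisson
  majorant\<close>

text \<open>On the circle \<open>cnj t = 1 / t\<close>, so \<open>Re t\<close> and
  \<open>Im t\<close> are Laurent polynomials in \<open>t\<close>. These are closed under sums and
  products, and a power of \<open>t\<close> serves as common denominator.\<close>

lemma laurent_polynomial_of_real_polynomial_function:
  fixes u :: "complex \<Rightarrow> real"
  assumes "real_polynomial_function u"
  shows "\<exists>p N. \<forall>t\<in>sphere 0 1. of_real (u t) = poly p t / t ^ N"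
  using assms
proof induction
  case (linear h)
  interpret bounded_linear h by fact
  \<comment> \<open>Real linearity gives \<open>h t = Re t * h 1 + Im t * h \<i>\<close>. Inserting
    \<open>Re t = (t + 1/t) / 2\<close> and \<open>Im t = - (\<i>/2) * (t - 1/t)\<close> and
    multiplying by \<open>t\<close> produces these coefficients.\<close>
  have "of_real (h t) = poly [:(h 1 + \<i> * h \<i>) / 2, 0, (h 1 - \<i> * h \<i>) / 2:] t / t ^ 1"
    if "t \<in> sphere 0 1" for t
  proof -
    have t: "t * cnj t = 1" "t \<noteq> 0" using that by (auto simp: complex_norm_square[symmetric])
    have "t = Re t *\<^sub>R 1 + Im t *\<^sub>R \<i>" by (simp add: complex_eq_iff)
    then have "h t = Re t * h 1 + Im t * h \<i>" by (metis add scaleR real_scaleR_def)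
    moreover have "cnj t = 1 / t" using t by (simp add: eq_divide_eq mult.commute)
    then have "of_real (Re t) = (t + 1 / t) / 2" "of_real (Im t) = - (\<i> / 2) * (t - 1 / t)"
      using complex_add_cnj[of t] complex_diff_cnj[of t] by (simp_all add: mult_ac)
    ultimately have eq: "of_real (h t) = (t + 1 / t) / 2 * of_real (h 1) - \<i> / 2 * (t - 1 / t) * of_real (h \<i>)"
      by (simp only: of_real_add of_real_mult) simp
    show ?thesis unfolding eq using t(2) by (simp add: field_simps)
  qed
  then show ?case by blast
next
  case (const c)
  show ?case by (intro exI[of _ "[:of_real c:]"] exI[of _ 0]) simp
next
  case (add f g)
  then obtain p N q M where "\<forall>t\<in>sphere 0 1. of_real (f t) = poly p t / t ^ N"
    "\<forall>t\<in>sphere 0 1. of_real (g t) = poly q t / t ^ M" by blast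
  moreover have "t \<noteq> 0" if "t \<in> sphere 0 1" for t :: complex
    using that by auto
  ultimately have "\<forall>t\<in>sphere 0 1. of_real (f t + g t) = poly (p * monom 1 M + q * monom 1 N) t / t ^ (N + M)"
    by (simp add: poly_monom add_frac_eq power_add mult_ac)
  then show ?case by blast
next
  case (mult f g)
  then obtain p N q M where "\<forall>t\<in>sphere 0 1. of_real (f t) = poly p t / t ^ N"
    "\<forall>t\<in>sphere 0 1. of_real (g t) = poly q t / t ^ M" by blast
  then have "\<forall>t\<in>sphere 0 1. of_real (f t * g t) = poly (p * q) t / t ^ (N + M)"
    by (auto simp: field_simps power_add)
  then show ?case by blast
qed

text \<open>Conjugating a term leaves its real part unchanged, and on the circle it turns a negative
  power of \<open>t\<close> into a positive one. Doing this to the terms with \<open>i < N\<close>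
  alone removes the pole at 0.\<close>

lemma Re_laurent_polynomial_on_circle:
  fixes p :: "complex poly"
  shows "\<exists>q. q holomorphic_on UNIV \<and> (\<forall>t\<in>sphere 0 1. Re (q t) = Re (poly p t / t ^ N))"
proof -
  define q where "q t = (\<Sum>i\<le>degree p. if N \<le> i then coeff p i * t ^ (i - N)
    else cnj (coeff p i) * t ^ (N - i))" for t
  have "q holomorphic_on UNIV"
    unfolding q_def
  proof (intro holomorphic_on_sum)
    fix i
    show "(\<lambda>t. if N \<le> i then coeff p i * t ^ (i - N) else cnj (coeff p i) * t ^ (N - i)) holomorphic_on UNIV"
      by (cases "N \<le> i") (auto intro!: holomorphic_intros)
  qed
  moreover have "Re (q t) = Re (poly p t / t ^ N)" if "t \<in> sphere 0 1" for t
  proof -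
    have t0: "t \<noteq> 0" and cnjt: "cnj t = 1 / t"
      using that complex_norm_square[of t] by (auto simp: eq_divide_eq mult.commute)
    have "Re (if N \<le> i then coeff p i * t ^ (i - N) else cnj (coeff p i) * t ^ (N - i))
        = Re (coeff p i * t ^ i / t ^ N)" for i
    proof (cases "N \<le> i")
      case False
      then have "coeff p i * t ^ i / t ^ N = cnj (cnj (coeff p i) * t ^ (N - i))"
        using t0 by (simp add: cnjt field_simps flip: power_add)
      then show ?thesis
        unfolding if_not_P[OF False] by (simp only: cnj.sel)
    qed (use t0 in \<open>simp add: power_diff\<close>)
    then show ?thesis
      unfolding q_def poly_altdef sum_divide_distrib Re_sum by (intro sum.cong) auto
  qed
  ultimately show ?thesis by blast
qed

lemma circle_approx_Re_entire:
  fixes v :: "complex \<Rightarrow> real"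
  assumes "continuous_on (sphere 0 1) v" "e > 0"
  shows "\<exists>q. q holomorphic_on UNIV \<and> (\<forall>t\<in>sphere 0 1. \<bar>v t - Re (q t)\<bar> < e)"
proof -
  obtain g where g: "real_polynomial_function g" "\<And>t. t \<in> sphere 0 1 \<Longrightarrow> \<bar>v t - g t\<bar> < e"
    using Stone_Weierstrass_real_polynomial_function[OF compact_sphere assms] by blast
  obtain p N where p: "\<forall>t\<in>sphere 0 1. of_real (g t) = poly p t / t ^ N"
    using laurent_polynomial_of_real_polynomial_function[OF g(1)] by blast
  obtain q where "q holomorphic_on UNIV" "\<forall>t\<in>sphere 0 1. Re (q t) = Re (poly p t / t ^ N)"
    using Re_laurent_polynomial_on_circle by blast
  moreover from this p have "\<forall>t\<in>sphere 0 1. Re (q t) = g t"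
    by (metis Re_complex_of_real)
  ultimately show ?thesis using g(2) by auto
qed

text \<open>Working with a majorant \<open>v\<close> of \<open>ln |f|\<close> that is the real part of an entire function up to
  \<open>e\<close> makes the maximum principle for \<open>f exp (-q)\<close> applicable regardless of the zeros of \<open>f\<close>.\<close>

lemma norm_le_exp_poisson_integral:
  assumes f: "f holomorphic_on ball 0 1" "continuous_on (cball 0 1) f"
    and v: "continuous_on (sphere 0 1) v" "\<And>t. t \<in> sphere 0 1 \<Longrightarrow> norm (f t) \<le> exp (v t)"
    and z: "norm z < 1"
  shows "norm (f z) \<le> exp (\<integral>t. poisson_kernel z t * v t \<partial>circle_measure)"
proof -
  let ?I = "\<integral>t. poisson_kernel z t * v t \<partial>circle_measure"
  \<comment> \<open>The constant function 1 in the Poisson formula gives the total mass of the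
    kernel.\<close>
  have one: "(\<integral>t. poisson_kernel z t \<partial>circle_measure) = 1"
    using poisson_formula_entire[of "\<lambda>_. 1" z] z by simp
  note P = continuous_on_poisson_kernel[OF z]
  \<comment> \<open>One \<open>e\<close> comes from the boundary bound on
    \<open>f * exp (- q)\<close>, the other from replacing \<open>Re q\<close> by \<open>v\<close>
    under a kernel of total mass 1.\<close>
  have bound: "norm (f z) \<le> exp (?I + 2 * e)" if "e > 0" for e
  proof -
    obtain q where q: "q holomorphic_on UNIV" "\<forall>t\<in>sphere 0 1. \<bar>v t - Re (q t)\<bar> < e"
      using circle_approx_Re_entire[OF v(1) \<open>e > 0\<close>] by blast
    have contq: "continuous_on S q" for S
      using holomorphic_on_imp_continuous_on[OF q(1)] by (rule continuous_on_subset) simp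
    have "norm (f z * exp (- q z)) \<le> exp e"
    proof (rule maximum_modulus_frontier[where S = "ball 0 1" and f = "\<lambda>z. f z * exp (- q z)"])
      show "(\<lambda>z. f z * exp (- q z)) holomorphic_on interior (ball 0 1)"
        by (auto intro!: holomorphic_intros f(1) holomorphic_on_subset[OF q(1)])
      show "continuous_on (closure (ball 0 1)) (\<lambda>z. f z * exp (- q z))"
        by (auto intro!: continuous_intros f(2) contq)
      fix t :: complex assume "t \<in> frontier (ball 0 1)"
      then have t: "t \<in> sphere 0 1" by simp
      have "norm (f t * exp (- q t)) \<le> exp (v t) * exp (- Re (q t))"
        using v(2)[OF t] by (simp add: norm_mult)
      also have "\<dots> = exp (v t - Re (q t))" by (simp add: exp_diff exp_minus field_simps)
      also have "\<dots> \<le> exp e" using q(2) t by force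
      finally show "norm (f t * exp (- q t)) \<le> exp e" .
    qed (use z in auto)
    then have "norm (f z) * exp (- Re (q z)) \<le> exp e"
      by (simp only: norm_mult norm_exp_eq_Re uminus_complex.sel)
    then have "norm (f z) \<le> exp (Re (q z) + e)"
      by (simp add: exp_add exp_minus field_simps)
    also have "Re (q z) = (\<integral>t. poisson_kernel z t * Re (q t) \<partial>circle_measure)"
      by (rule poisson_formula_entire[OF q(1) z, symmetric])
    also have "\<dots> \<le> (\<integral>t. poisson_kernel z t * v t + e * poisson_kernel z t \<partial>circle_measure)"
    proof (rule integral_mono)
      fix t assume "t \<in> space circle_measure"
      then have "Re (q t) \<le> v t + e" using q(2) by force
      then have "poisson_kernel z t * Re (q t) \<le> poisson_kernel z t * (v t + e)"
        by (rule mult_left_mono) (rule poisson_kernel_nonneg[OF z])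
      then show "poisson_kernel z t * Re (q t) \<le> poisson_kernel z t * v t + e * poisson_kernel z t"
        by (simp add: algebra_simps)
    qed (auto intro!: integrable_circle_continuous continuous_intros P v(1) contq)
    also have "\<dots> = ?I + e"
      using P v(1)
      by (subst Bochner_Integration.integral_add)
         (auto intro!: integrable_circle_continuous continuous_intros simp: one)
    finally show ?thesis by (simp add: algebra_simps)
  qed
  have "((\<lambda>e. exp (?I + 2 * e)) \<longlongrightarrow> exp (?I + 2 * 0)) (at_right 0)"
    by (intro tendsto_intros)
  moreover have "eventually (\<lambda>e. norm (f z) \<le> exp (?I + 2 * e)) (at_right 0)"
    using bound by (auto simp: eventually_at_right_less intro: eventually_mono[OF eventually_at_right_less])
  ultimately show ?thesis
    by (intro tendsto_lowerbound[of "\<lambda>e. exp (?I + 2 * e)"]) auto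
qed

section \<open>Passage to the limit under uniform integrability\<close>

text \<open>A form of Vitali's convergence theorem. Off the set \<open>D n\<close> where
  \<open>w n\<close> exceeds a small threshold, the integral is small because the measure is finite.
  The measure of \<open>D n\<close> tends to 0 by dominated convergence of indicators, so uniform
  integrability controls the integral over \<open>D n\<close>.\<close>

lemma (in finite_measure) uniformly_integrable_tendsto_0:
  fixes w :: "nat \<Rightarrow> 'a \<Rightarrow> real"
  assumes int: "\<And>n. integrable M (w n)"
    and nonneg: "\<And>n t. t \<in> space M \<Longrightarrow> 0 \<le> w n t"
    and ae: "AE t in M. (\<lambda>n. w n t) \<longlonglongrightarrow> 0"
    and ui: "\<And>e. e > 0 \<Longrightarrow> \<exists>d>0. \<forall>n. \<forall>D\<in>sets M. measure M D < d \<longrightarrow>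
      (\<integral>t. indicator D t * w n t \<partial>M) < e"
  shows "(\<lambda>n. \<integral>t. w n t \<partial>M) \<longlonglongrightarrow> 0"
proof (rule LIMSEQ_I)
  fix e :: real assume "e > 0"
  \<comment> \<open>The added 1 keeps the denominator positive and makes \<open>e'\<close> times the
    total mass strictly less than \<open>e / 2\<close>.\<close>
  define e' where "e' = e / (2 * (measure M (space M) + 1))"
  have e': "e' > 0" "e' * measure M (space M) < e / 2"
    using \<open>e > 0\<close> by (simp_all add: e'_def field_simps add_pos_nonneg)
  define D where "D n = {t \<in> space M. w n t > e'}" for n
  have [measurable]: "w n \<in> borel_measurable M" for n
    using int by blast
  have D [measurable]: "D n \<in> sets M" for n
    unfolding D_def by measurable
  obtain d where d: "d > 0" "\<And>n D. D \<in> sets M \<Longrightarrow> measure M D < d \<Longrightarrow>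
      (\<integral>t. indicator D t * w n t \<partial>M) < e / 2"
    using ui[of "e / 2"] \<open>e > 0\<close> by auto
  have "(\<lambda>n. \<integral>t. indicat_real (D n) t \<partial>M) \<longlonglongrightarrow> (\<integral>t. 0 \<partial>M)"
  proof (rule integral_dominated_convergence[where w = "\<lambda>_. 1"])
    show "AE t in M. (\<lambda>n. indicat_real (D n) t) \<longlonglongrightarrow> 0"
      using ae
    proof eventually_elim
      case (elim t)
      then have "eventually (\<lambda>n. w n t < e') sequentially"
        using e'(1) by (rule order_tendstoD)
      then have "eventually (\<lambda>n. indicat_real (D n) t = 0) sequentially"
        by eventually_elim (simp add: D_def)
      then show ?case by (rule tendsto_eventually)
    qed
  qed (auto simp: indicator_def)
  then have "eventually (\<lambda>n. measure M (D n) < d) sequentially"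
    using d(1) by (intro order_tendstoD) auto
  then obtain N where N: "\<And>n. n \<ge> N \<Longrightarrow> measure M (D n) < d"
    unfolding eventually_sequentially by blast
  have "norm ((\<integral>t. w n t \<partial>M) - 0) < e" if "n \<ge> N" for n
  proof -
    have intD: "integrable M (\<lambda>t. indicator (D n) t * w n t)"
      using integrable_mult_indicator[OF D int] by simp
    have "(\<integral>t. w n t \<partial>M) \<le> (\<integral>t. e' + indicator (D n) t * w n t \<partial>M)"
      using intD e'(1) by (intro integral_mono int) (auto simp: D_def indicator_def)
    also have "\<dots> = e' * measure M (space M) + (\<integral>t. indicator (D n) t * w n t \<partial>M)"
      using intD by (subst Bochner_Integration.integral_add) auto
    also have "\<dots> < e"
      using d(2)[OF D N[OF that], of n] e'(2) by linarith
    finally show ?thesis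
      using nonneg by (simp add: Bochner_Integration.integral_nonneg)
  qed
  then show "\<exists>N. \<forall>n\<ge>N. norm ((\<integral>t. w n t \<partial>M) - 0) < e" by blast
qed

section \<open>The maximum principle for scalar functions of the Smirnov class\<close>

lemma ln_plus_eq_ln_max: "ln_plus x = ln (max x 1)"
  by (simp add: ln_plus_def max_def)

lemma ln_plus_mono: "x \<le> y \<Longrightarrow> ln_plus x \<le> ln_plus y"
  by (auto simp: ln_plus_eq_ln_max max_def)

text \<open>This carries the uniform integrability of \<open>ln_plus\<close> of the modulus over to
  the logarithm truncated at \<open>c\<close>, up to a constant that is small when integrated over
  small sets.\<close>

lemma ln_max_diff_le_ln_plus:
  assumes "c > 0"
  shows "ln (max x c) - ln c \<le> ln_plus x + \<bar>ln c\<bar>"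
  using assms by (auto simp: ln_plus_def max_def)

text \<open>Uniform integrability is what excludes functions such as
  \<open>exp ((1 + z) / (1 - z))\<close>, which is unbounded in the disc although its radial limits
  have modulus 1 almost everywhere.\<close>

lemma smirnov_scalar_maximum_principle:
  fixes f :: "complex \<Rightarrow> complex"
  assumes hol: "f holomorphic_on ball 0 1"
    and ui: "\<And>\<epsilon>. \<epsilon> > 0 \<Longrightarrow> \<exists>\<delta>>0. \<forall>r\<in>{0..<1}. \<forall>\<Delta>\<in>sets circle_measure.
        measure circle_measure \<Delta> < \<delta> \<longrightarrow>
        (\<integral>\<^sup>+t\<in>\<Delta>. ennreal (ln_plus (norm (f (of_real r * t)))) \<partial>circle_measure) < ennreal \<epsilon>"
    and lim: "AE t in circle_measure. \<exists>l. ((\<lambda>r. f (of_real r * t)) \<longlongrightarrow> l) (at_left (1::real)) \<and> norm l \<le> C"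
    and C: "C > 0" and z: "norm z < 1"
  shows "norm (f z) \<le> C"
proof -
  \<comment> \<open>A sequence of radii makes dominated convergence available; it starts at 0 and
    stays below 1, as the uniform integrability condition demands.\<close>
  define r where "r n = real n / real (Suc n)" for n
  have r: "0 \<le> r n" "r n < 1" for n by (simp_all add: r_def)
  have r_lim: "r \<longlonglongrightarrow> 1"
    unfolding r_def by (rule LIMSEQ_n_over_Suc_n)
  then have r_left: "filterlim r (at_left 1) sequentially"
    using r unfolding filterlim_at by (auto simp: less_imp_neq)
  define g where "g n t = f (of_real (r n) * t)" for n t
  \<comment> \<open>Dilation by \<open>r n < 1\<close> sends the closed disc into the open one, so
    \<open>g n\<close> is continuous up to the circle although \<open>f\<close> is controlled only
    inside.\<close>
  have r_ball: "of_real (r n) * t \<in> ball 0 1" if "norm t \<le> 1" for n and t :: complex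
    using mult_mono[of "r n" "r n" "norm t" 1] that r[of n] by (simp add: norm_mult)
  have contf: "continuous_on (ball 0 1) f"
    using hol by (rule holomorphic_on_imp_continuous_on)
  have contg: "continuous_on (cball 0 1) (g n)" for n
    unfolding g_def by (rule continuous_on_compose2[OF contf]) (use r_ball in \<open>auto intro!: continuous_intros\<close>)
  then have contg': "continuous_on (sphere 0 1) (g n)" for n
    by (rule continuous_on_subset) auto
  have holg: "g n holomorphic_on ball 0 1" for n
  proof -
    have "f \<circ> (\<lambda>t. of_real (r n) * t) holomorphic_on ball 0 1"
      by (rule holomorphic_on_compose_gen[OF _ hol]) (use r_ball in \<open>auto intro!: holomorphic_intros\<close>)
    then show ?thesis by (simp add: g_def[abs_def] o_def)
  qed
  \<comment> \<open>Truncating at \<open>C\<close> keeps the logarithm finite and continuous at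
    zeros of \<open>g n\<close>, and makes the excess \<open>w n\<close> nonnegative.\<close>
  define v where "v n t = ln (max (norm (g n t)) C)" for n t
  define w where "w n t = v n t - ln C" for n t
  have contv: "continuous_on (sphere 0 1) (v n)" for n
    unfolding v_def
    by (intro continuous_on_ln continuous_on_max continuous_intros contg') (use C in auto)
  then have contw: "continuous_on (sphere 0 1) (w n)" for n
    unfolding w_def by (intro continuous_intros)
  have w_nonneg: "0 \<le> w n t" for n t
    using C by (simp add: w_def v_def)
  note P = continuous_on_poisson_kernel[OF z]
  \<comment> \<open>Since the kernel has integral 1, the constant \<open>ln C\<close> split off from
    \<open>v n\<close> comes out as the factor \<open>C\<close>.\<close>
  have est: "norm (f (of_real (r n) * z)) \<le> C * exp (\<integral>t. poisson_kernel z t * w n t \<partial>circle_measure)" for n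
  proof -
    have "norm (g n t) \<le> exp (v n t)" for t
      using C by (simp add: v_def)
    then have "norm (g n z) \<le> exp (\<integral>t. poisson_kernel z t * v n t \<partial>circle_measure)"
      by (intro norm_le_exp_poisson_integral holg contg contv z)
    also have "(\<integral>t. poisson_kernel z t * v n t \<partial>circle_measure) =
        (\<integral>t. poisson_kernel z t * w n t + ln C * poisson_kernel z t \<partial>circle_measure)"
      by (intro Bochner_Integration.integral_cong) (auto simp: w_def algebra_simps)
    also have "\<dots> = (\<integral>t. poisson_kernel z t * w n t \<partial>circle_measure) + ln C"
      using P contw poisson_formula_entire[of "\<lambda>_. 1" z] z
      by (subst Bochner_Integration.integral_add)
         (auto intro!: integrable_circle_continuous continuous_intros)
    finally show ?thesis using C by (simp add: g_def exp_add mult.commute)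
  qed
  have "(\<lambda>n. \<integral>t. w n t \<partial>circle_measure) \<longlonglongrightarrow> 0"
  proof (rule circle.uniformly_integrable_tendsto_0)
    show "integrable circle_measure (w n)" for n
      by (rule integrable_circle_continuous[OF contw])
    show "AE t in circle_measure. (\<lambda>n. w n t) \<longlonglongrightarrow> 0"
      using lim
    proof eventually_elim
      case (elim t)
      then obtain l where l: "((\<lambda>r. f (of_real r * t)) \<longlongrightarrow> l) (at_left (1::real))" "norm l \<le> C"
        by blast
      have "(\<lambda>n. g n t) \<longlonglongrightarrow> l"
        unfolding g_def by (rule filterlim_compose[OF l(1) r_left])
      \<comment> \<open>The limit is 0: the boundary bound \<open>norm l \<le> C\<close> makes the
        truncation take the value \<open>C\<close>.\<close>
      then have "(\<lambda>n. w n t) \<longlonglongrightarrow> ln (max (norm l) C) - ln C"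
        unfolding w_def v_def using C by (intro tendsto_intros) (auto simp: max_def)
      then show ?case using l(2) by (simp add: max_def)
    qed
  next
    fix e :: real assume e: "e > 0"
    obtain d where d: "d > 0" "\<And>n D. D \<in> sets circle_measure \<Longrightarrow> measure circle_measure D < d \<Longrightarrow>
        (\<integral>\<^sup>+t\<in>D. ennreal (ln_plus (norm (g n t))) \<partial>circle_measure) < ennreal (e / 2)"
      using ui[of "e / 2"] e r unfolding g_def by (auto simp: atLeastLessThan_iff)
    \<comment> \<open>The first entry makes the \<open>ln_plus\<close> part less than
      \<open>e / 2\<close>, the second bounds the contribution of \<open>\<bar>ln C\<bar>\<close> by
      \<open>e / 2\<close>. The added 1 covers \<open>C = 1\<close>, where \<open>ln C\<close>
      vanishes.\<close>
    define d' where "d' = min d (e / (2 * (\<bar>ln C\<bar> + 1)))"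
    have "(\<integral>t. indicator D t * w n t \<partial>circle_measure) < e"
      if D: "D \<in> sets circle_measure" and small: "measure circle_measure D < d'" for D n
    proof -
      have L: "integrable circle_measure (\<lambda>t. ln_plus (norm (g n t)))"
        unfolding ln_plus_eq_ln_max
        by (intro integrable_circle_continuous continuous_on_ln continuous_on_max continuous_intros contg') auto
      then have LD: "integrable circle_measure (\<lambda>t. indicator D t * ln_plus (norm (g n t)))"
        using integrable_mult_indicator[OF D L] by simp
      have wD: "integrable circle_measure (\<lambda>t. indicator D t * w n t)"
        using integrable_mult_indicator[OF D integrable_circle_continuous[OF contw]] by simp
      have Dint: "integrable circle_measure (\<lambda>t. \<bar>ln C\<bar> * indicator D t)"
        using circle.emeasure_finite[of D]
        by (intro integrable_mult_right integrable_real_indicator D) (simp add: less_top[symmetric])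
      have "ennreal (\<integral>t. indicator D t * ln_plus (norm (g n t)) \<partial>circle_measure) =
          (\<integral>\<^sup>+t\<in>D. ennreal (ln_plus (norm (g n t))) \<partial>circle_measure)"
        by (subst nn_integral_eq_integral[OF LD, symmetric])
           (auto intro!: nn_integral_cong simp: indicator_def ln_plus_def)
      also have "\<dots> < ennreal (e / 2)"
        using small by (intro d(2)[OF D]) (simp add: d'_def)
      finally have 1: "(\<integral>t. indicator D t * ln_plus (norm (g n t)) \<partial>circle_measure) < e / 2"
        using e by (simp add: ennreal_less_iff Bochner_Integration.integral_nonneg ln_plus_def)
      have "(\<bar>ln C\<bar> + 1) * measure circle_measure D \<le> (\<bar>ln C\<bar> + 1) * (e / (2 * (\<bar>ln C\<bar> + 1)))"
        using small by (intro mult_left_mono) (auto simp: d'_def)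
      also have "\<dots> = e / 2"
        by (simp add: field_simps)
      finally have 2: "\<bar>ln C\<bar> * measure circle_measure D \<le> e / 2"
        using measure_nonneg[of circle_measure D] unfolding distrib_right by linarith
      have "(\<integral>t. indicator D t * w n t \<partial>circle_measure) \<le>
          (\<integral>t. indicator D t * ln_plus (norm (g n t)) + \<bar>ln C\<bar> * indicator D t \<partial>circle_measure)"
        using ln_max_diff_le_ln_plus[OF C]
        by (intro integral_mono wD Bochner_Integration.integrable_add LD Dint)
           (auto simp: indicator_def w_def v_def)
      also have "\<dots> = (\<integral>t. indicator D t * ln_plus (norm (g n t)) \<partial>circle_measure) +
          \<bar>ln C\<bar> * measure circle_measure D"
        using D sets.sets_into_space[OF D]
        by (subst Bochner_Integration.integral_add[OF LD Dint]) (auto simp: Int_absorb2)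
      finally show ?thesis using 1 2 by linarith
    qed
    moreover have "d' > 0" using d(1) e by (simp add: d'_def)
    ultimately show "\<exists>d>0. \<forall>n. \<forall>D\<in>sets circle_measure. measure circle_measure D < d \<longrightarrow>
        (\<integral>t. indicator D t * w n t \<partial>circle_measure) < e" by blast
  qed (rule w_nonneg)
  \<comment> \<open>For fixed \<open>z\<close> the kernel is bounded on the circle, so weighting by
    it costs only a factor \<open>B\<close> and the weighted integrals of \<open>w n\<close> are
    squeezed to 0 as well.\<close>
  moreover obtain B where B: "B > 0" "\<And>t. t \<in> sphere 0 1 \<Longrightarrow> poisson_kernel z t \<le> B"
    using poisson_kernel_bounded[OF z] by blast
  moreover have "(\<integral>t. poisson_kernel z t * w n t \<partial>circle_measure) \<le> B * (\<integral>t. w n t \<partial>circle_measure)" for n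
    unfolding integral_mult_right_zero[symmetric]
    using B(2) w_nonneg P contw
    by (intro integral_mono integrable_circle_continuous continuous_intros mult_right_mono) auto
  ultimately have est': "norm (f (of_real (r n) * z)) \<le> C * exp (B * (\<integral>t. w n t \<partial>circle_measure))" for n
    by (intro order_trans[OF est]) (use C in auto)
  have "(\<lambda>n. C * exp (B * (\<integral>t. w n t \<partial>circle_measure))) \<longlonglongrightarrow> C * exp (B * 0)"
    by (intro tendsto_intros) fact
  moreover have "(\<lambda>n. norm (f (of_real (r n) * z))) \<longlonglongrightarrow> norm (f z)"
  proof (intro tendsto_norm isCont_tendsto_compose[of z f])
    show "isCont f z"
      using contf z by (auto simp: continuous_on_eq_continuous_at)
    show "(\<lambda>n. of_real (r n) * z) \<longlonglongrightarrow> z"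
      using tendsto_mult[OF tendsto_of_real[OF r_lim, where 'a = complex] tendsto_const[of z]] by simp
  qed
  ultimately show ?thesis
    using est' by (intro LIMSEQ_le[where X = "\<lambda>n. norm (f (of_real (r n) * z))"]) auto
qed

section \<open>The Hermitian pairing, the operator norm, and the reduction from matrices to
  scalars\<close>

lemma norm_sum_cnj_mult_le:
  fixes y v :: "complex ^ 'n"
  shows "norm (\<Sum>i\<in>UNIV. cnj (y $ i) * v $ i) \<le> norm y * norm v"
proof -
  have "norm (\<Sum>i\<in>UNIV. cnj (y $ i) * v $ i) \<le> (\<Sum>i\<in>UNIV. \<bar>norm (y $ i)\<bar> * \<bar>norm (v $ i)\<bar>)"
    by (rule order_trans[OF norm_sum]) (simp add: norm_mult)
  also have "\<dots> \<le> norm y * norm v"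
    unfolding norm_vec_def by (rule L2_set_mult_ineq)
  finally show ?thesis .
qed

lemma sum_cnj_mult_self:
  fixes y :: "complex ^ 'n"
  shows "(\<Sum>i\<in>UNIV. cnj (y $ i) * y $ i) = of_real ((norm y)\<^sup>2)"
proof -
  have "cnj (y $ i) * y $ i = of_real ((norm (y $ i))\<^sup>2)" for i
    using complex_norm_square[of "y $ i"] by (simp add: mult.commute)
  then show ?thesis
    by (simp add: norm_vec_def L2_set_def sum_nonneg)
qed

lemma norm_matrix_vector_le_opnorm:
  fixes A :: "complex ^ 'n ^ 'n"
  shows "norm (A *v x) \<le> opnorm A * norm x"
  unfolding opnorm_def by (rule onorm) simp

lemma opnorm_nonneg:
  fixes A :: "complex ^ 'n ^ 'n"
  shows "0 \<le> opnorm A"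
  unfolding opnorm_def by (rule onorm_pos_le) simp

lemma tendsto_matrix_vector_mult:
  fixes A :: "complex ^ 'n ^ 'n"
  assumes "(F \<longlongrightarrow> A) L"
  shows "((\<lambda>r. F r *v x) \<longlongrightarrow> A *v x) L"
  unfolding matrix_vector_mult_def
  by (rule vec_tendstoI) (auto intro!: tendsto_intros assms)

text \<open>Convergence here is in the library topology on matrices. It implies convergence on each
  vector, and the bound passes to the limit one vector at a time.\<close>

lemma opnorm_le_of_tendsto:
  fixes A :: "complex ^ 'n ^ 'n"
  assumes "(F \<longlongrightarrow> A) L" "L \<noteq> bot" "eventually (\<lambda>r. opnorm (F r) \<le> c) L"
  shows "opnorm A \<le> c"
  unfolding opnorm_def
proof (rule onorm_le)
  fix x
  have "eventually (\<lambda>r. norm (F r *v x) \<le> c * norm x) L"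
    using assms(3)
    by eventually_elim (metis norm_matrix_vector_le_opnorm mult_right_mono norm_ge_zero order_trans)
  then show "norm (A *v x) \<le> c * norm x"
    using tendsto_norm[OF tendsto_matrix_vector_mult[OF assms(1)]] assms(2)
    by (intro tendsto_upperbound) auto
qed

text \<open>For fixed \<open>x\<close>, pairing \<open>F w *v x\<close> with the fixed vector
  \<open>y = F z *v x\<close> gives a scalar function of \<open>w\<close> dominated by
  \<open>opnorm (F w)\<close>. It inherits uniform integrability and the boundary bound, and at
  \<open>w = z\<close> the pairing attains the length of \<open>F z *v x\<close>.\<close>

lemma smirnov_opnorm_le:
  fixes F G :: "complex \<Rightarrow> complex ^ 'n ^ 'n"
  assumes F: "F \<in> smirnov" and G: "boundary_function F G"
    and s: "AE t in circle_measure. opnorm (G t) \<le> s" "0 \<le> s" and z: "norm z < 1"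
  shows "opnorm (F z) \<le> s"
  unfolding opnorm_def
proof (rule onorm_le)
  fix x
  define y where "y = F z *v x"
  show "norm (F z *v x) \<le> s * norm x"
  proof (cases "y = 0")
    case True
    then show ?thesis using s(2) by (simp add: y_def)
  next
    case False
    then have "x \<noteq> 0" by (auto simp: y_def)
    \<comment> \<open>With this normalization Cauchy-Schwarz gives
      \<open>norm (\<phi> A) \<le> opnorm A\<close>, while \<open>\<phi> (F z)\<close> equals
      \<open>norm y / norm x\<close>, the quotient to be bounded.\<close>
    define k where "k = norm y * norm x"
    have k: "k > 0" using False \<open>x \<noteq> 0\<close> by (simp add: k_def)
    define \<phi> where "\<phi> A = (\<Sum>i\<in>UNIV. cnj (y $ i) * (A *v x) $ i) / of_real k" for A :: "complex ^ 'n ^ 'n"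
    have \<phi>_le: "norm (\<phi> A) \<le> opnorm A" for A
    proof -
      have "norm (\<Sum>i\<in>UNIV. cnj (y $ i) * (A *v x) $ i) \<le> norm y * (opnorm A * norm x)"
        by (intro order_trans[OF norm_sum_cnj_mult_le] mult_left_mono norm_matrix_vector_le_opnorm) simp
      then show ?thesis
        using k by (simp add: \<phi>_def norm_divide divide_le_eq) (simp add: k_def mult_ac)
    qed
    \<comment> \<open>The scalar principle takes a positive bound, and \<open>s\<close> may be 0;
      hence the slack \<open>e\<close>.\<close>
    have "norm (\<phi> (F z)) \<le> s + e" if "e > 0" for e
    proof (rule smirnov_scalar_maximum_principle[where f = "\<lambda>w. \<phi> (F w)"])
      show "(\<lambda>w. \<phi> (F w)) holomorphic_on ball 0 1"
        using F k unfolding \<phi>_def matrix_vector_mult_def smirnov_def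
        by (auto intro!: holomorphic_intros)
      show "AE t in circle_measure. \<exists>l. ((\<lambda>r. \<phi> (F (of_real r * t))) \<longlongrightarrow> l) (at_left (1::real)) \<and> norm l \<le> s + e"
        using s(1) conjunct2[OF G[unfolded boundary_function_def]]
      proof eventually_elim
        case (elim t)
        then have "((\<lambda>r. \<phi> (F (of_real r * t))) \<longlongrightarrow> \<phi> (G t)) (at_left (1::real))"
          unfolding \<phi>_def using k
          by (intro tendsto_intros tendsto_matrix_vector_mult) auto
        moreover have "norm (\<phi> (G t)) \<le> s + e"
          using \<phi>_le[of "G t"] elim(1) \<open>e > 0\<close> by linarith
        ultimately show ?case by blast
      qed
    next
      fix \<epsilon> :: real assume "\<epsilon> > 0"
      then obtain \<delta> where \<delta>: "\<delta> > 0" "\<forall>r\<in>{0..<1}. \<forall>\<Delta>\<in>sets circle_measure. measure circle_measure \<Delta> < \<delta> \<longrightarrow>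
          (\<integral>\<^sup>+t\<in>\<Delta>. ennreal (ln_plus (opnorm (F (of_real r * t)))) \<partial>circle_measure) < ennreal \<epsilon>"
        using F unfolding smirnov_def by blast
      have "(\<integral>\<^sup>+t\<in>\<Delta>. ennreal (ln_plus (norm (\<phi> (F (of_real r * t))))) \<partial>circle_measure) \<le>
          (\<integral>\<^sup>+t\<in>\<Delta>. ennreal (ln_plus (opnorm (F (of_real r * t)))) \<partial>circle_measure)" for \<Delta> and r :: real
        by (intro nn_integral_mono mult_right_mono ennreal_leI ln_plus_mono \<phi>_le) simp
      then show "\<exists>\<delta>>0. \<forall>r\<in>{0..<1}. \<forall>\<Delta>\<in>sets circle_measure. measure circle_measure \<Delta> < \<delta> \<longrightarrow>
          (\<integral>\<^sup>+t\<in>\<Delta>. ennreal (ln_plus (norm (\<phi> (F (of_real r * t))))) \<partial>circle_measure) < ennreal \<epsilon>"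
        using \<delta> by (meson order_le_less_trans)
    qed (use s(2) that z in auto)
    then have "norm (\<phi> (F z)) \<le> s" by (rule field_le_epsilon)
    moreover have "\<phi> (F z) = of_real (norm y / norm x)"
      using False \<open>x \<noteq> 0\<close> sum_cnj_mult_self[of y]
      by (simp add: \<phi>_def k_def power2_eq_square flip: y_def)
    ultimately show ?thesis
      using \<open>x \<noteq> 0\<close> by (simp add: y_def norm_divide divide_le_eq)
  qed
qed

section \<open>Equality of the supremum over the disc and the essential supremum on the
  circle\<close>

theorem mainTheorem4:
  fixes F G :: "complex \<Rightarrow> complex ^ 'n ^ 'n"
  assumes "F \<in> smirnov"
    and "boundary_function F G"
    and "esssup circle_measure (\<lambda>t. ereal (opnorm (G t))) < \<infinity>"
  shows "bdd_above ((\<lambda>z. opnorm (F z)) ` ball 0 1) \<and>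
    (SUP z\<in>ball 0 1. ereal (opnorm (F z))) = esssup circle_measure (\<lambda>t. ereal (opnorm (G t)))"
proof -
  let ?S = "esssup circle_measure (\<lambda>t. ereal (opnorm (G t)))"
  let ?T = "SUP z\<in>ball 0 1. ereal (opnorm (F z))"
  \<comment> \<open>The library gives \<open>esssup\<close> of a non-measurable function the value
    top, so finiteness yields measurability.\<close>
  have meas: "(\<lambda>t. ereal (opnorm (G t))) \<in> borel_measurable circle_measure"
    using assms(3) esssup_non_measurable[of "\<lambda>t. ereal (opnorm (G t))" circle_measure]
    by (auto simp: top_ereal_def)
  have S: "AE t in circle_measure. ereal (opnorm (G t)) \<le> ?S"
    by (rule esssup_AE)
  have "0 \<le> ?S"
  proof -
    \<comment> \<open>A probability measure is not zero, so a statement free of \<open>t\<close>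
      that holds almost everywhere is true.\<close>
    have "AE t in circle_measure. 0 \<le> ?S"
      using S by eventually_elim (metis ereal_less_eq(5) opnorm_nonneg order_trans)
    then show ?thesis by simp
  qed
  with assms(3) obtain s where s: "?S = ereal s" "0 \<le> s"
    by (cases ?S) auto
  have le: "opnorm (F z) \<le> s" if "norm z < 1" for z
    using S that s by (intro smirnov_opnorm_le[OF assms(1,2)]) auto
  have "?T \<le> ?S"
    unfolding s(1) using le by (intro SUP_least) auto
  \<comment> \<open>At almost every \<open>t\<close> the boundary value is a radial limit of
    matrices \<open>F (of_real r * t)\<close>, whose operator norms are at most
    \<open>?T\<close>.\<close>
  moreover have "?S \<le> ?T"
  proof (rule esssup_I[OF meas])
    have "AE t in circle_measure. t \<in> sphere 0 1"
      by (rule AE_I2) simp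
    then show "AE t in circle_measure. ereal (opnorm (G t)) \<le> ?T"
      using conjunct2[OF assms(2)[unfolded boundary_function_def]]
    proof eventually_elim
      case (elim t)
      \<comment> \<open>The value at the centre bounds \<open>?T\<close> from below by 0; with the
        upper bound \<open>?S\<close> it is a real number \<open>c\<close>, and the limit argument
        can run in the reals.\<close>
      have "ereal (opnorm (F 0)) \<le> ?T" by (rule SUP_upper) simp
      then have "0 \<le> ?T" using opnorm_nonneg[of "F 0"] by (metis ereal_less_eq(5) order_trans)
      with \<open>?T \<le> ?S\<close> obtain c where c: "?T = ereal c"
        unfolding s(1) by (cases ?T) auto
      have "eventually (\<lambda>r. r \<in> {0<..<1}) (at_left (1::real))"
        by (rule eventually_at_leftI[of 0]) auto
      then have "eventually (\<lambda>r. opnorm (F (of_real r * t)) \<le> c) (at_left (1::real))"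
      proof eventually_elim
        case (elim r)
        then have "of_real r * t \<in> ball 0 1"
          using \<open>t \<in> sphere 0 1\<close> by (simp add: norm_mult)
        then have "ereal (opnorm (F (of_real r * t))) \<le> ?T" by (rule SUP_upper)
        then show ?case by (simp add: c)
      qed
      then have "opnorm (G t) \<le> c"
        using elim(2) by (intro opnorm_le_of_tendsto) auto
      then show ?case by (simp add: c)
    qed
  qed
  moreover have "bdd_above ((\<lambda>z. opnorm (F z)) ` ball 0 1)"
    using le by (intro bdd_aboveI[of _ s]) auto
  ultimately show ?thesis by (simp add: antisym)
qed

end
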